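(* Let $R$ be a commutative associative unital ring with $3R=0$. Then there is a group isomorphism $\mathrm{Aut}_R(W_2(R))\cong R^\times\times\mathrm{Aff}_2(R)$ under which the center $Z(\mathrm{Aut}_R(W_2(R)))$ corresponds to the first factor $R^\times$; modulo this identification both subgroups $R^\times$ and $\mathrm{Aff}_2(R)$ are normal subgroups. Moreover, the elements of $\mathrm{Aut}_R(W_2(R))$ are exactly the $R$-linear maps whose matrix relative to the basis $e_1,\dots,e_6$ is of the form $$M_{a,b,c}=\begin{pmatrix} 1&0&c&0&0&0\\ -\frac{c}{a}&\frac1a&\frac{c^2}{a}&-\frac{c^3}{a}&0&0\\ 0&0&a&0&0&0\\ 0&0&0&a^2&0&0\\ b-1&0&(b-1)c&0&b&bc\\ 0&0&a(b-1)&0&0&ab \end{pmatrix},\qquad a,b\in R^\times,\ c\in R.$$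
   Context: $W_2(R)=\bigoplus_{i=1}^6Re_i$ is the (non-associative) $R$-algebra, free as an $R$-module with basis $e_1,\dots,e_6$, with $R$-bilinear product given by (zero products omitted): $e_1e_1=-e_1$, $e_1e_2=-3e_2$, $e_1e_3=e_3$, $e_1e_4=3e_4$, $e_1e_5=-e_5$, $e_1e_6=e_6$; $e_2e_1=3e_2$, $e_2e_3=2e_1$, $e_2e_4=e_3$, $e_2e_6=-e_5$; $e_3e_1=-2e_3$, $e_3e_2=-e_1$, $e_3e_3=-3e_4$, $e_3e_5=e_6$; $e_5e_1=-2e_1$, $e_5e_2=-3e_2$, $e_5e_3=-e_3$, $e_5e_5=-2e_5$, $e_5e_6=-e_6$; $e_6e_1=2e_3$, $e_6e_2=e_1$, $e_6e_3=3e_4$, $e_6e_5=-e_6$. Matrix convention: the $i$-th row of the matrix of a linear map $\theta$ consists of the coordinates of $\theta(e_i)$ in the basis. $R^\times$ is the group of units of $R$ and $\mathrm{Aff}_2(R)=\left\{\begin{pmatrix}1&x\\0&t\end{pmatrix}: x\in R,\ t\in R^\times\right\}$ under matrix multiplication. $\mathrm{Aut}_R$ denotes the group of $R$-algebra automorphisms. *)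

theory Defs
  imports "HOL-Analysis.Cartesian_Space" "HOL-Algebra.Coset"
begin

text \<open>Commutative, associative, unital rings. Unlike \<^class>\<open>comm_ring_1\<close>, the zero ring is
  included.\<close>

class comm_unital_ring = comm_ring + comm_monoid_mult
begin
subclass semiring_numeral ..
subclass neg_numeral ..
end

subclass (in comm_ring_1) comm_unital_ring ..

definition units_group :: "'a::comm_unital_ring monoid" where
  "units_group = \<lparr>carrier = {u. u dvd 1}, monoid.mult = (*), one = 1\<rparr>"

definition matrix_prod :: "'a::comm_unital_ring ^'n ^'m \<Rightarrow> 'a ^'p ^'n \<Rightarrow> 'a ^'p ^'m" where
  \<comment> \<open>the product \<open>**\<close> of the library, which is restricted to \<^class>\<open>semiring_1\<close> and hence to nonzero rings\<close>
  "matrix_prod A B = (\<chi> i j. \<Sum>k\<in>UNIV. A $ i $ k * B $ k $ j)"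

definition aff2_group :: "('a::comm_unital_ring ^ 2 ^ 2) monoid" where
  "aff2_group =
     \<lparr>carrier = {vector [vector [1, x], vector [0, t]] | x t. t dvd 1},
      monoid.mult = matrix_prod, one = mat 1\<rparr>"

definition group_center :: "('g, 'm) monoid_scheme \<Rightarrow> 'g set" where
  "group_center G =
     {z \<in> carrier G. \<forall>g \<in> carrier G. z \<otimes>\<^bsub>G\<^esub> g = g \<otimes>\<^bsub>G\<^esub> z}"

text \<open>The underlying module of \<open>W\<^sub>2(R)\<close> is \<open>R\<^sup>6\<close>, indexed by the six-element numeral type, whose
  elements are 1, 2, 3, 4, 5 and 6 = 0.\<close>

abbreviation W2_e :: "6 \<Rightarrow> 'a::comm_unital_ring ^ 6" where
  "W2_e i \<equiv> axis i 1"

text \<open>The entry in row \<open>i\<close> and column \<open>j\<close> is the product of \<open>W2_e i\<close> and \<open>W2_e j\<close>.\<close>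

definition W2_table :: "'a::comm_unital_ring ^ 6 ^ 6 ^ 6" where
  "W2_table = vector
    [vector [- W2_e 1, (- 3) *s W2_e 2, W2_e 3, 3 *s W2_e 4, - W2_e 5, W2_e 6],
     vector [3 *s W2_e 2, 0, 2 *s W2_e 1, W2_e 3, 0, - W2_e 5],
     vector [(- 2) *s W2_e 3, - W2_e 1, (- 3) *s W2_e 4, 0, W2_e 6, 0],
     vector [0, 0, 0, 0, 0, 0],
     vector [(- 2) *s W2_e 1, (- 3) *s W2_e 2, - W2_e 3, 0, (- 2) *s W2_e 5, - W2_e 6],
     vector [2 *s W2_e 3, W2_e 1, 3 *s W2_e 4, 0, - W2_e 6, 0]]"

definition W2_mult :: "'a::comm_unital_ring ^ 6 \<Rightarrow> 'a ^ 6 \<Rightarrow> 'a ^ 6" where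
  "W2_mult x y = (\<Sum>i\<in>UNIV. \<Sum>j\<in>UNIV. (x $ i * y $ j) *s W2_table $ i $ j)"

definition R_linear :: "('a::comm_unital_ring ^ 'n \<Rightarrow> 'a ^ 'm) \<Rightarrow> bool" where
  "R_linear f \<longleftrightarrow> (\<forall>x y. f (x + y) = f x + f y) \<and> (\<forall>r x. f (r *s x) = r *s f x)"

definition W2_Aut :: "('a::comm_unital_ring ^ 6 \<Rightarrow> 'a ^ 6) monoid" where
  "W2_Aut =
     \<lparr>carrier = {f. R_linear f \<and> bij f \<and> (\<forall>x y. f (W2_mult x y) = W2_mult (f x) (f y))},
      monoid.mult = (\<circ>), one = id\<rparr>"

text \<open>Row convention: row \<open>i\<close> consists of the coordinates of \<open>f (W2_e i)\<close>. This is the transpose of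
  the library's \<^const>\<open>matrix\<close>.\<close>

definition row_matrix :: "('a::comm_unital_ring ^ 6 \<Rightarrow> 'a ^ 6) \<Rightarrow> 'a ^ 6 ^ 6" where
  "row_matrix f = (\<chi> i. f (W2_e i))"

definition W2_matrix :: "'a::comm_unital_ring \<Rightarrow> 'a \<Rightarrow> 'a \<Rightarrow> 'a ^ 6 ^ 6" where
  "W2_matrix a b c =
    (let a' = inv\<^bsub>units_group\<^esub> a in
     vector
      [vector [1, 0, c, 0, 0, 0],
       vector [- (c * a'), a', c ^ 2 * a', - (c ^ 3 * a'), 0, 0],
       vector [0, 0, a, 0, 0, 0],
       vector [0, 0, 0, a ^ 2, 0, 0],
       vector [b - 1, 0, (b - 1) * c, 0, b, b * c],
       vector [0, 0, a * (b - 1), 0, 0, a * b]])"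

lemma group_units_group: "group (units_group :: 'a::comm_unital_ring monoid)"
proof (rule groupI)
  fix x y :: 'a assume "x \<in> carrier units_group" "y \<in> carrier units_group"
  then obtain x' y' where "1 = x * x'" "1 = y * y'" by (auto simp: units_group_def dvd_def)
  hence "1 = (x * y) * (x' * y')" by (metis mult.commute mult.left_commute mult_1)
  thus "x \<otimes>\<^bsub>units_group\<^esub> y \<in> carrier units_group"
    by (auto simp: units_group_def intro: dvdI)
next
  fix x :: 'a assume "x \<in> carrier units_group"
  thus "\<exists>y\<in>carrier units_group. y \<otimes>\<^bsub>units_group\<^esub> x = \<one>\<^bsub>units_group\<^esub>"
    by (auto simp: units_group_def dvd_def) (metis mult.commute)
qed (auto simp: units_group_def mult.assoc intro: dvdI[of _ _ 1])

lemma matrix_prod_aff2: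
  "matrix_prod (vector [vector [1, x], vector [0, t]] :: 'a::comm_unital_ring ^ 2 ^ 2)
       (vector [vector [1, x'], vector [0, t']]) =
     (vector [vector [1, x' + x * t'], vector [0, t * t']] :: 'a ^ 2 ^ 2)"
  by (simp add: vec_eq_iff matrix_prod_def forall_2 sum_2)

lemma aff2_one: "mat 1 = (vector [vector [1, 0], vector [0, 1]] :: 'a::comm_unital_ring ^ 2 ^ 2)"
  by (simp add: vec_eq_iff mat_def forall_2)

lemma group_aff2_group: "group (aff2_group :: ('a::comm_unital_ring ^ 2 ^ 2) monoid)"
proof (rule groupI)
  fix A B :: "'a ^ 2 ^ 2" assume "A \<in> carrier aff2_group" "B \<in> carrier aff2_group"
  then obtain x t x' t' where "A = vector [vector [1, x], vector [0, t]]" "t dvd 1"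
    "B = vector [vector [1, x'], vector [0, t']]" "t' dvd 1"
    by (auto simp: aff2_group_def)
  moreover from this have "t * t' dvd 1"
    using group.is_monoid[OF group_units_group, THEN monoid.m_closed, of t t']
    by (simp add: units_group_def)
  ultimately show "A \<otimes>\<^bsub>aff2_group\<^esub> B \<in> carrier aff2_group"
    by (auto simp: aff2_group_def matrix_prod_aff2)
next
  show "(\<one>\<^bsub>aff2_group\<^esub> :: 'a ^ 2 ^ 2) \<in> carrier aff2_group"
    by (force simp: aff2_group_def aff2_one intro: dvdI[of "1::'a" 1 1])
next
  fix A :: "'a ^ 2 ^ 2" assume "A \<in> carrier aff2_group"
  then obtain x t s where A: "A = vector [vector [1, x], vector [0, t]]" and s: "1 = t * s"
    by (auto simp: aff2_group_def dvd_def)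
  have "s dvd 1" using s by (metis dvdI mult.commute)
  moreover have "x + - (x * s) * t = 0"
    by (metis s add.right_inverse minus_mult_left mult.assoc mult.commute mult.right_neutral)
  moreover have "s * t = 1" using s by (simp add: mult.commute)
  ultimately show "\<exists>B\<in>carrier aff2_group. B \<otimes>\<^bsub>aff2_group\<^esub> A = \<one>\<^bsub>aff2_group\<^esub>"
    unfolding A by (intro bexI[of _ "vector [vector [1, - (x * s)], vector [0, s]]"])
      (auto simp: aff2_group_def matrix_prod_aff2 aff2_one)
qed (auto simp: aff2_group_def matrix_prod_aff2 aff2_one algebra_simps)

lemma group_W2_Aut: "group (W2_Aut :: ('a::comm_unital_ring ^ 6 \<Rightarrow> 'a ^ 6) monoid)"
proof (rule groupI)
  fix f :: "'a ^ 6 \<Rightarrow> 'a ^ 6" assume f: "f \<in> carrier W2_Aut"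
  define g where "g = Hilbert_Choice.inv f"
  have fg: "\<And>x. f (g x) = x" and gf: "\<And>x. g (f x) = x" and "bij g"
    using f by (auto simp: W2_Aut_def g_def bij_is_surj surj_f_inv_f bij_is_inj bij_imp_bij_inv)
  have add: "\<And>x y. f (x + y) = f x + f y" and scale: "\<And>r x. f (r *s x) = r *s f x"
    and mult: "\<And>x y. f (W2_mult x y) = W2_mult (f x) (f y)"
    using f by (auto simp: W2_Aut_def R_linear_def)
  have "g \<in> carrier W2_Aut"
    unfolding W2_Aut_def R_linear_def using \<open>bij g\<close>
    by simp (metis fg gf add scale mult)
  thus "\<exists>g\<in>carrier W2_Aut. g \<otimes>\<^bsub>W2_Aut\<^esub> f = \<one>\<^bsub>W2_Aut\<^esub>"
    using gf by (intro bexI[of _ g]) (auto simp: W2_Aut_def fun_eq_iff)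
qed (auto simp: W2_Aut_def R_linear_def bij_comp comp_assoc)

end

theory Submission
  imports Defs
begin

text \<open>
  If \<open>3 = 0\<close>, the product of \<open>W\<^sub>2(R)\<close> degenerates: left multiplication by \<open>x\<close> depends only on
  \<open>p = x\<^sub>5 - x\<^sub>1\<close>, \<open>q = x\<^sub>3 - x\<^sub>6\<close> and \<open>x\<^sub>2\<close>, and every product lies in the span \<open>S\<close> of
  \<open>e\<^sub>1, e\<^sub>3, e\<^sub>5, e\<^sub>6\<close> (\<open>W2_mult_nth\<close>). These four vectors are themselves products, so \<open>S\<close> is the square of
  the algebra, and automorphisms preserve it. This yields enough invariant submodules to determine
  an automorphism \<open>\<theta>\<close>, over any ring and without division:

  \<^item> The vectors \<open>y\<close> with \<open>S y = 0\<close> are the multiples of \<open>e\<^sub>4\<close>, so \<open>\<theta>(e\<^sub>4)\<close> is a multiple of \<open>e\<^sub>4\<close>.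
  \<^item> As \<open>e\<^sub>3 = e\<^sub>2e\<^sub>4\<close> and the product of any vector with \<open>e\<^sub>4\<close> is a multiple of \<open>e\<^sub>3\<close>, also
    \<open>\<theta>(e\<^sub>3) = a e\<^sub>3\<close>. The same holds for \<open>\<theta>\<^sup>-\<^sup>1\<close>, so \<open>a\<close> is a unit.
  \<^item> The remaining rows follow from single products of basis vectors: \<open>e\<^sub>3e\<^sub>1\<close> and \<open>e\<^sub>1e\<^sub>1\<close> give
    \<open>\<theta>(e\<^sub>1) = e\<^sub>1 + c e\<^sub>3\<close>; then \<open>e\<^sub>5e\<^sub>3\<close> and \<open>e\<^sub>1e\<^sub>5\<close> leave one parameter \<open>b\<close> in \<open>\<theta>(e\<^sub>5)\<close>;
    \<open>e\<^sub>6 = e\<^sub>3e\<^sub>5\<close>; and \<open>e\<^sub>3e\<^sub>2\<close>, \<open>e\<^sub>1e\<^sub>2\<close>, \<open>e\<^sub>2e\<^sub>2\<close>, \<open>e\<^sub>2e\<^sub>4\<close> fix \<open>\<theta>(e\<^sub>2)\<close> and \<open>\<theta>(e\<^sub>4)\<close>.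

  So \<open>\<theta>\<close> has matrix \<open>M\<^sub>a\<^sub>,\<^sub>b\<^sub>,\<^sub>c\<close> (\<open>W2_Aut_row_matrix\<close>). The parameter \<open>b\<close> is a unit because it is
  multiplicative in \<open>\<theta>\<close>. Conversely, expansion in coordinates shows that each \<open>M\<^sub>a\<^sub>,\<^sub>b\<^sub>,\<^sub>c\<close> with units
  \<open>a\<close>, \<open>b\<close> gives an automorphism (\<open>W2_map_in_Aut\<close>).

  The group structure can be read off from two rows: \<open>\<theta>\<close> acts on the coefficient of \<open>e\<^sub>5\<close> by \<open>b\<close>, and the
  row of \<open>e\<^sub>2\<close> starts with \<open>-c/a\<close>, \<open>1/a\<close>, which compose like the entries \<open>x\<close>, \<open>t\<close> of the affine group
  (\<open>W2_params_iso\<close>). Since \<open>R\<^sup>\<times>\<close> is commutative and the affine group has trivial center when \<open>3 = 0\<close>, the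
  center is the first factor. Both factors are normal as kernels of the projections.
\<close>

section \<open>Coordinates on six-dimensional vectors\<close>

lemma exhaust_6: "x = 1 \<or> x = 2 \<or> x = 3 \<or> x = 4 \<or> x = 5 \<or> x = 6" for x :: 6
proof (induct x)
  case (of_int z)
  then have "z = 0 \<or> z = 1 \<or> z = 2 \<or> z = 3 \<or> z = 4 \<or> z = 5" by fastforce
  then show ?case by auto
qed

lemma forall_6: "(\<forall>i::6. P i) \<longleftrightarrow> P 1 \<and> P 2 \<and> P 3 \<and> P 4 \<and> P 5 \<and> P 6"
  by (metis exhaust_6)

lemma UNIV_6: "(UNIV :: 6 set) = {1, 2, 3, 4, 5, 6}"
  using exhaust_6 by auto

lemma sum_6: "sum f (UNIV::6 set) = f 1 + f 2 + f 3 + f 4 + f 5 + f 6"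
  unfolding UNIV_6 by (simp add: ac_simps)

lemma vector_6 [simp]:
  "(vector [u, v, w, x, y, z] :: 'a::zero ^ 6) $ 1 = u"
  "(vector [u, v, w, x, y, z] :: 'a ^ 6) $ 2 = v"
  "(vector [u, v, w, x, y, z] :: 'a ^ 6) $ 3 = w"
  "(vector [u, v, w, x, y, z] :: 'a ^ 6) $ 4 = x"
  "(vector [u, v, w, x, y, z] :: 'a ^ 6) $ 5 = y"
  "(vector [u, v, w, x, y, z] :: 'a ^ 6) $ 6 = z"
  unfolding vector_def by simp_all

lemma axis_6_nth:
  "(axis i u :: 'a::zero ^ 6) $ j = (if j = i then u else 0)"
  by (simp add: axis_def)

section \<open>Units and centers of groups\<close>

lemma units_group_simps [simp]:
  "(a \<in> carrier units_group) = (a dvd 1)"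
  "a \<otimes>\<^bsub>units_group\<^esub> b = a * b"
  "\<one>\<^bsub>units_group\<^esub> = 1"
  by (simp_all add: units_group_def)

lemma units_group_inv_eq:
  assumes "a * t = (1::'a::comm_unital_ring)"
  shows "inv\<^bsub>units_group\<^esub> a = t"
proof -
  have "a dvd 1" "t dvd 1"
    using assms by (metis dvdI mult.commute)+
  then show ?thesis
    using assms by (intro group.inv_equality[OF group_units_group]) (simp_all add: mult.commute)
qed

text \<open>
  Cancellation of \<open>u\<close> against its inverse \<open>v\<close> across up to three intermediate factors: these rewrite
  rules reduce the right-nested products that come out of expanding the matrix entries.
\<close>

lemma unit_inverse_cancel:
  fixes u v x y z w :: "'a::comm_unital_ring"
  assumes "u * v = 1"
  shows "u * (v * z) = z" "u * (x * (v * z)) = x * z" "u * (x * (y * (v * z))) = x * (y * z)"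
    "u * (x * (y * (w * (v * z)))) = x * (y * (w * z))"
proof -
  show *: "u * (v * z) = z" for z
    using assms by (metis mult.assoc mult_1)
  have **: "v * (u * z) = z" for z
    using * by (metis mult.left_commute)
  show "u * (x * (v * z)) = x * z" "u * (x * (y * (v * z))) = x * (y * z)"
    "u * (x * (y * (w * (v * z)))) = x * (y * (w * z))"
    by (simp_all only: mult.left_commute[of u] **)
qed

lemma group_center_iso_image:
  assumes iso: "\<phi> \<in> iso G H" and "group G"
  shows "\<phi> ` group_center G = group_center H"
proof -
  have bij: "inj_on \<phi> (carrier G)" "\<phi> ` carrier G = carrier H"
    and mult: "\<And>x y. x \<in> carrier G \<Longrightarrow> y \<in> carrier G \<Longrightarrow> \<phi> (x \<otimes>\<^bsub>G\<^esub> y) = \<phi> x \<otimes>\<^bsub>H\<^esub> \<phi> y"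
    using iso by (auto simp: iso_def hom_def bij_betw_def)
  have "\<phi> z \<in> group_center H \<longleftrightarrow> z \<in> group_center G" if z: "z \<in> carrier G" for z
  proof -
    have "\<phi> z \<in> group_center H \<longleftrightarrow>
        (\<forall>g\<in>carrier G. \<phi> (z \<otimes>\<^bsub>G\<^esub> g) = \<phi> (g \<otimes>\<^bsub>G\<^esub> z))"
      using z by (auto simp: group_center_def mult bij(2)[symmetric])
    also have "\<dots> \<longleftrightarrow> z \<in> group_center G"
      using z \<open>group G\<close> inj_on_eq_iff[OF bij(1)]
      by (auto simp: group_center_def group.is_monoid monoid.m_closed)
    finally show ?thesis .
  qed
  then have "group_center H \<inter> carrier H = \<phi> ` (group_center G \<inter> carrier G)"
    unfolding bij(2)[symmetric] by blast
  moreover have "group_center G \<subseteq> carrier G" "group_center H \<subseteq> carrier H"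
    by (auto simp: group_center_def)
  ultimately show ?thesis
    by (simp add: Int_absorb2)
qed

lemma group_center_DirProd:
  assumes "group G" "group H"
  shows "group_center (G \<times>\<times> H) = group_center G \<times> group_center H"
proof -
  have one: "\<one>\<^bsub>G\<^esub> \<in> carrier G" "\<one>\<^bsub>H\<^esub> \<in> carrier H"
    using assms by (simp_all add: group.is_monoid monoid.one_closed)
  have "(x, y) \<in> group_center (G \<times>\<times> H) \<longleftrightarrow> x \<in> group_center G \<and> y \<in> group_center H" for x y
  proof -
    have "(x, y) \<in> group_center (G \<times>\<times> H) \<longleftrightarrow> x \<in> carrier G \<and> y \<in> carrier H \<and>
        (\<forall>g\<in>carrier G. \<forall>h\<in>carrier H. x \<otimes>\<^bsub>G\<^esub> g = g \<otimes>\<^bsub>G\<^esub> x \<and> y \<otimes>\<^bsub>H\<^esub> h = h \<otimes>\<^bsub>H\<^esub> y)"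
      by (simp add: group_center_def)
    also have "\<dots> \<longleftrightarrow> x \<in> group_center G \<and> y \<in> group_center H"
      unfolding group_center_def using one by blast
    finally show ?thesis .
  qed
  then show ?thesis
    by auto
qed

section \<open>Linear maps from matrices in the row convention\<close>

definition row_map :: "'a::comm_unital_ring ^ 6 ^ 6 \<Rightarrow> 'a ^ 6 \<Rightarrow> 'a ^ 6" where
  "row_map M x = (\<Sum>i\<in>UNIV. x $ i *s M $ i)"

lemma row_map_nth: "row_map M x $ j = (\<Sum>i\<in>UNIV. x $ i * M $ i $ j)"
  by (simp add: row_map_def)

lemma R_linear_row_map: "R_linear (row_map M)"
  by (simp add: R_linear_def vec_eq_iff row_map_nth distrib_right sum.distrib
      sum_distrib_left mult.assoc)

lemma row_matrix_row_map: "row_matrix (row_map M) = M"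
  by (simp add: vec_eq_iff row_matrix_def row_map_nth axis_6_nth sum_6 forall_6)

lemma R_linear_imp_row_map:
  fixes f :: "'a::comm_unital_ring ^ 6 \<Rightarrow> 'a ^ 6"
  assumes "R_linear f"
  shows "f = row_map (row_matrix f)"
proof
  fix x :: "'a ^ 6"
  have add: "f (u + v) = f u + f v" and scale: "f (r *s u) = r *s f u" for u v r
    using assms by (auto simp: R_linear_def)
  have "x = x $ 1 *s W2_e 1 + x $ 2 *s W2_e 2 + x $ 3 *s W2_e 3 + x $ 4 *s W2_e 4
      + x $ 5 *s W2_e 5 + x $ 6 *s W2_e 6"
    by (simp add: vec_eq_iff forall_6 axis_6_nth)
  then have "f x = f (x $ 1 *s W2_e 1 + x $ 2 *s W2_e 2 + x $ 3 *s W2_e 3 + x $ 4 *s W2_e 4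
      + x $ 5 *s W2_e 5 + x $ 6 *s W2_e 6)"
    by (rule arg_cong)
  then show "f x = row_map (row_matrix f) x"
    by (simp add: add scale row_map_def row_matrix_def sum_6)
qed

text \<open>The maps of the theorem in coordinates, with \<open>t\<close> standing for \<open>1/a\<close>.\<close>

lemma W2_map_nth:
  fixes a t b c :: "'a::comm_unital_ring"
  assumes "a * t = 1"
  defines "f \<equiv> row_map (W2_matrix a b c)"
  shows "f x $ 1 = x $ 1 - c * t * x $ 2 + (b - 1) * x $ 5"
    and "f x $ 2 = t * x $ 2"
    and "f x $ 3 = c * x $ 1 + c * c * t * x $ 2 + a * x $ 3 + (b - 1) * c * x $ 5
      + a * (b - 1) * x $ 6"
    and "f x $ 4 = a * a * x $ 4 - c * c * c * t * x $ 2"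
    and "f x $ 5 = b * x $ 5"
    and "f x $ 6 = b * c * x $ 5 + a * b * x $ 6"
  unfolding f_def row_map_nth W2_matrix_def Let_def units_group_inv_eq[OF assms(1)]
  by (simp_all add: sum_6 power2_eq_square power3_eq_cube algebra_simps)

text \<open>
  On the map of \<open>M\<^sub>a\<^sub>,\<^sub>b\<^sub>,\<^sub>c\<close> this is \<open>b\<close> together with the affine matrix of \<open>x = -c/a\<close>, \<open>t = 1/a\<close>. In terms of
  \<open>c\<close> and \<open>a\<close> themselves one would obtain an anti-homomorphism: composition of maps reverses the
  product of matrices in the row convention.
\<close>

definition W2_params :: "('a::comm_unital_ring ^ 6 \<Rightarrow> 'a ^ 6) \<Rightarrow> 'a \<times> ('a ^ 2 ^ 2)" where
  "W2_params f =
     (f (W2_e 5) $ 5, vector [vector [1, f (W2_e 2) $ 1], vector [0, f (W2_e 2) $ 2]])"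

section \<open>The product when three vanishes\<close>

context
  assumes char_3: "\<forall>r::'a::comm_unital_ring. 3 * r = 0"
begin

text \<open>
  Over a ring with \<open>3 = 0\<close> a negative is a double, so all identities between polynomial expressions
  can be checked by expanding into sums of monomials and deleting triples of equal ones.
\<close>

lemma triple_eq_0: "x + (x + x) = (0::'a)"
proof -
  have "(3::'a) = 1 + (1 + 1)"
    by (simp only: numeral_Bit1 numeral_One add.assoc)
  then show ?thesis
    using char_3 by (metis distrib_right mult_1)
qed

lemma triple_add_eq: "x + (x + (x + y)) = (y::'a)"
  using triple_eq_0[of x] by (metis add.assoc add_0)

lemma uminus_char_3: "- x = x + (x::'a)"
  using triple_eq_0[of x] by (metis minus_unique)

lemma minus_char_3: "x - y = x + (y + (y::'a))"
  using uminus_char_3[of y] by (metis diff_conv_add_uminus)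

lemmas char_3_simps = uminus_char_3 minus_char_3 triple_eq_0 triple_add_eq
  distrib_left distrib_right mult.assoc mult.commute mult.left_commute
  add.assoc add.commute add.left_commute

lemma numerals_char_3: "2 = (- 1::'a)" "3 = (0::'a)"
proof -
  show "3 = (0::'a)" using char_3[rule_format, of 1] by simp
  have "(2::'a) = 1 + 1"
    by (simp only: numeral_Bit0 numeral_One)
  then show "2 = (- 1::'a)" by (simp add: uminus_char_3)
qed

text \<open>
  Since \<open>3 = 0\<close>, the rows \<open>e\<^sub>5\<close> and \<open>e\<^sub>6\<close> of the multiplication table are the negatives of the rows \<open>e\<^sub>1\<close> and
  \<open>e\<^sub>3\<close>, and the row \<open>e\<^sub>4\<close> is zero. Hence the left factor enters only through \<open>p\<close>, \<open>q\<close> and \<open>x\<^sub>2\<close>. The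
  coefficients that would produce \<open>e\<^sub>2\<close> or \<open>e\<^sub>4\<close> are multiples of 3.
\<close>

lemma W2_mult_nth:
  fixes x y :: "'a ^ 6"
  defines "p \<equiv> x $ 5 - x $ 1" and "q \<equiv> x $ 3 - x $ 6"
  shows "W2_mult x y $ 1 = p * y $ 1 - x $ 2 * y $ 3 - q * y $ 2"
    and "W2_mult x y $ 2 = 0"
    and "W2_mult x y $ 3 = q * y $ 1 - p * y $ 3 + x $ 2 * y $ 4"
    and "W2_mult x y $ 4 = 0"
    and "W2_mult x y $ 5 = p * y $ 5 - x $ 2 * y $ 6"
    and "W2_mult x y $ 6 = q * y $ 5 - p * y $ 6"
  unfolding W2_mult_def W2_table_def p_def q_def
  by (simp_all add: sum_6 axis_6_nth numerals_char_3) (simp_all add: char_3_simps)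

section \<open>The matrices of the theorem give automorphisms\<close>

text \<open>
  The maps compose by \<open>(a, b, c)(a', b', c') = (aa', bb', c' a + c)\<close>, which explains the parameters
  of the inverse. The third coordinate of the composite carries the extra term \<open>3 c\<^sup>2 x\<^sub>2\<close>, which
  vanishes here.
\<close>

lemma W2_map_inverse:
  fixes a t b s c :: 'a
  assumes at: "a * t = 1" and bs: "b * s = 1"
  shows "row_map (W2_matrix a b c) (row_map (W2_matrix t s (- (c * t))) x) = x"
proof -
  have ta: "t * a = 1" using at by (simp add: mult.commute)
  show ?thesis
    by (simp add: vec_eq_iff forall_6 W2_map_nth[OF at] W2_map_nth[OF ta])
       (simp add: algebra_simps at bs unit_inverse_cancel[OF at] unit_inverse_cancel[OF bs] triple_eq_0)
qed

text \<open>
  The map acts on the data of a left factor by \<open>p \<mapsto> p + ct x\<^sub>2\<close>, \<open>x\<^sub>2 \<mapsto> t x\<^sub>2\<close> and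
  \<open>q \<mapsto> a q - c p + c\<^sup>2t x\<^sub>2\<close>, where \<open>b\<close> no longer occurs. Substituting this in the product formula
  and expanding, the two sides differ by multiples of 3, such as \<open>3 c\<^sup>2t\<^sup>2 x\<^sub>2y\<^sub>2\<close> in the first coordinate.
\<close>

lemma W2_map_mult:
  fixes a t b c :: 'a
  assumes at: "a * t = 1"
  defines "f \<equiv> row_map (W2_matrix a b c)"
  shows "f (W2_mult x y) = W2_mult (f x) (f y)"
proof -
  show ?thesis
    unfolding f_def
    by (simp add: vec_eq_iff forall_6 W2_map_nth[OF at] W2_mult_nth)
       (simp add: at unit_inverse_cancel[OF at] char_3_simps del: one_add_one)
qed

lemma W2_map_in_Aut:
  fixes a b c :: 'a
  assumes "a dvd 1" "b dvd 1"
  shows "row_map (W2_matrix a b c) \<in> carrier W2_Aut"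
proof -
  obtain t where at: "a * t = 1"
    using assms(1) unfolding dvd_def by metis
  obtain s where bs: "b * s = 1"
    using assms(2) unfolding dvd_def by metis
  have ta: "t * a = 1" and sb: "s * b = 1"
    using at bs by (simp_all add: mult.commute)
  have "- (- (c * t) * a) = c"
    using ta by (simp add: mult.assoc)
  then have "bij (row_map (W2_matrix a b c))"
    using W2_map_inverse[OF at bs, of c] W2_map_inverse[OF ta sb, of "- (c * t)"]
    by (intro o_bij[of "row_map (W2_matrix t s (- (c * t)))"]) (simp_all add: fun_eq_iff)
  then show ?thesis
    by (simp add: W2_Aut_def R_linear_row_map W2_map_mult[OF at])
qed

section \<open>Every automorphism has such a matrix\<close>

text \<open>
  The products that determine an automorphism. The first four exhibit \<open>e\<^sub>1\<close>, \<open>e\<^sub>3\<close>, \<open>e\<^sub>5\<close>, \<open>e\<^sub>6\<close> as products.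
\<close>

lemma W2_basis_products:
  "W2_mult (W2_e 5) (W2_e 1) = (W2_e 1 :: 'a ^ 6)"
  "W2_mult (W2_e 1) (W2_e 3) = (W2_e 3 :: 'a ^ 6)"
  "W2_mult (W2_e 5) (W2_e 5) = (W2_e 5 :: 'a ^ 6)"
  "W2_mult (W2_e 1) (W2_e 6) = (W2_e 6 :: 'a ^ 6)"
  "W2_mult (W2_e 2) (W2_e 4) = (W2_e 3 :: 'a ^ 6)"
  "W2_mult (W2_e 3) (W2_e 1) = (W2_e 3 :: 'a ^ 6)"
  "W2_mult (W2_e 1) (W2_e 1) = (- W2_e 1 :: 'a ^ 6)"
  "W2_mult (W2_e 1) (W2_e 5) = (- W2_e 5 :: 'a ^ 6)"
  "W2_mult (W2_e 5) (W2_e 3) = (- W2_e 3 :: 'a ^ 6)"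
  "W2_mult (W2_e 3) (W2_e 5) = (W2_e 6 :: 'a ^ 6)"
  "W2_mult (W2_e 3) (W2_e 2) = (- W2_e 1 :: 'a ^ 6)"
  "W2_mult (W2_e 1) (W2_e 2) = (0 :: 'a ^ 6)"
  "W2_mult (W2_e 2) (W2_e 2) = (0 :: 'a ^ 6)"
  by (simp_all add: vec_eq_iff forall_6 W2_mult_nth axis_6_nth)

lemma W2_Aut_inverse:
  fixes f :: "'a ^ 6 \<Rightarrow> 'a ^ 6"
  assumes "f \<in> carrier W2_Aut"
  obtains g where "g \<in> carrier W2_Aut" "\<And>x. f (g x) = x" "\<And>x. g (f x) = x"
proof -
  interpret group "W2_Aut :: ('a ^ 6 \<Rightarrow> 'a ^ 6) monoid"
    by (rule group_W2_Aut)
  have "f \<circ> inv\<^bsub>W2_Aut\<^esub> f = id" "inv\<^bsub>W2_Aut\<^esub> f \<circ> f = id"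
    using r_inv[OF assms] l_inv[OF assms] by (simp_all add: W2_Aut_def)
  then show thesis
    using that[OF inv_closed[OF assms]] by (metis comp_apply id_apply)
qed

lemma W2_Aut_mult:
  "f \<in> carrier W2_Aut \<Longrightarrow> f (W2_mult x y) = W2_mult (f x) (f y)"
  by (simp add: W2_Aut_def)

lemma W2_Aut_linear:
  fixes f :: "'a ^ 6 \<Rightarrow> 'a ^ 6"
  assumes "f \<in> carrier W2_Aut"
  shows "f (x + y) = f x + f y" "f (r *s x) = r *s f x" "f 0 = 0" "f (- x) = - f x"
proof -
  show *: "f (x + y) = f x + f y" "f (r *s x) = r *s f x" for x y r
    using assms by (simp_all add: W2_Aut_def R_linear_def)
  show **: "f 0 = 0"
    using *(1)[of 0 0] by simp
  show "f (- x) = - f x"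
    using *(1)[of x "- x"] ** by (metis add.right_inverse minus_unique)
qed

text \<open>
  The vectors \<open>e\<^sub>1\<close>, \<open>e\<^sub>3\<close>, \<open>e\<^sub>5\<close>, \<open>e\<^sub>6\<close> are products, hence so are their images, and a product has no
  component along \<open>e\<^sub>2\<close> or \<open>e\<^sub>4\<close>.
\<close>

lemma W2_Aut_image_in_square:
  fixes f :: "'a ^ 6 \<Rightarrow> 'a ^ 6"
  assumes "f \<in> carrier W2_Aut" and "i \<in> {1, 3, 5, 6}"
  shows "f (W2_e i) $ 2 = 0" "f (W2_e i) $ 4 = 0"
proof -
  obtain u v :: "'a ^ 6" where "W2_e i = W2_mult u v"
    using assms(2) W2_basis_products(1-4) by (metis empty_iff insert_iff)
  then have "f (W2_e i) = W2_mult (f u) (f v)"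
    by (simp add: W2_Aut_mult[OF assms(1)])
  then show "f (W2_e i) $ 2 = 0" "f (W2_e i) $ 4 = 0"
    by (simp_all add: W2_mult_nth)
qed

text \<open>
  The span of \<open>e\<^sub>4\<close> is the set of vectors annihilated from the left by the square \<open>S\<close> of the algebra,
  which makes it invariant. Here \<open>e\<^sub>i f(e\<^sub>4) = f(f\<^sup>-\<^sup>1(e\<^sub>i) e\<^sub>4)\<close> vanishes for \<open>e\<^sub>i \<in> S\<close>, and \<open>i = 1\<close>, \<open>i = 3\<close>
  already force all coordinates of \<open>f(e\<^sub>4)\<close> but the fourth to be zero.
\<close>

lemma W2_Aut_e4:
  fixes f :: "'a ^ 6 \<Rightarrow> 'a ^ 6"
  assumes f: "f \<in> carrier W2_Aut"
  shows "f (W2_e 4) = f (W2_e 4) $ 4 *s W2_e 4"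
proof -
  obtain g where g: "g \<in> carrier W2_Aut" and fg: "\<And>x. f (g x) = x"
    using W2_Aut_inverse[OF f] by metis
  have "W2_mult (W2_e i) (f (W2_e 4)) = 0" if "i \<in> {1, 3, 5, 6}" for i
  proof -
    have "W2_mult (g (W2_e i)) (W2_e 4) = 0"
      using W2_Aut_image_in_square[OF g that]
      by (simp add: vec_eq_iff forall_6 W2_mult_nth axis_6_nth)
    then show ?thesis
      using W2_Aut_mult[OF f, of "g (W2_e i)" "W2_e 4"] by (simp add: fg W2_Aut_linear[OF f])
  qed
  from this[of 1] this[of 3] show ?thesis
    by (simp add: vec_eq_iff forall_6 W2_mult_nth axis_6_nth)
qed

text \<open>Right multiplication by \<open>e\<^sub>4\<close> sends every vector \<open>x\<close> to \<open>x\<^sub>2 e\<^sub>3\<close>, and \<open>e\<^sub>3 = e\<^sub>2e\<^sub>4\<close>.\<close>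

lemma W2_Aut_e3:
  fixes f :: "'a ^ 6 \<Rightarrow> 'a ^ 6"
  assumes f: "f \<in> carrier W2_Aut"
  shows "f (W2_e 3) = f (W2_e 3) $ 3 *s W2_e 3"
proof -
  have *: "f (W2_e 3) = W2_mult (f (W2_e 2)) (f (W2_e 4) $ 4 *s W2_e 4)"
    using W2_Aut_mult[OF f, of "W2_e 2" "W2_e 4"]
    by (simp add: W2_basis_products W2_Aut_e4[OF f, symmetric])
  show ?thesis
    unfolding * by (simp add: vec_eq_iff forall_6 W2_mult_nth axis_6_nth)
qed

text \<open>
  With \<open>f(e\<^sub>3) = a e\<^sub>3\<close> for a unit \<open>a\<close>, comparing coordinates in the images of single basis products
  determines the rows one after the other. That \<open>b\<close> is a unit is postponed: it needs the shape of the
  inverse as well.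
\<close>

lemma W2_Aut_row_matrix:
  fixes f :: "'a ^ 6 \<Rightarrow> 'a ^ 6"
  assumes f: "f \<in> carrier W2_Aut"
  shows "\<exists>a b c. a dvd 1 \<and> row_matrix f = W2_matrix a b c"
proof -
  obtain g where g: "g \<in> carrier W2_Aut" and fg: "\<And>x. f (g x) = x"
    using W2_Aut_inverse[OF f] by metis
  define a where "a = f (W2_e 3) $ 3"
  define t where "t = g (W2_e 3) $ 3"
  define b where "b = f (W2_e 5) $ 5"
  define c where "c = f (W2_e 1) $ 3"
  have f3: "f (W2_e 3) = a *s W2_e 3"
    using W2_Aut_e3[OF f] by (simp add: a_def)
  have "f (t *s W2_e 3) = W2_e 3"
    using W2_Aut_e3[OF g] fg by (simp add: t_def)
  then have at: "a * t = 1"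
    by (simp add: W2_Aut_linear[OF f] f3 vec_eq_iff axis_6_nth mult.commute forall_6)
  have cancel: "u = v" if "a * u = a * v" for u v
    using that at by (metis mult.assoc mult.commute mult_1)
  have cancel_0: "u = 0" if "a * u = 0" for u
    using cancel[of u 0] that by simp
  \<comment> \<open>A coordinate \<open>v\<close> with \<open>2v = -u\<close> equals \<open>u\<close>, because \<open>2 = -1\<close>.\<close>
  have halve: "v = u" if "u + v = - v" for u v :: 'a
    using that by (simp add: uminus_char_3)
  note prod = W2_Aut_mult[OF f, symmetric]
  note coords = vec_eq_iff forall_6 W2_mult_nth axis_6_nth W2_basis_products
    W2_Aut_linear[OF f] f3
  have S: "f (W2_e 1) $ 2 = 0" "f (W2_e 1) $ 4 = 0" "f (W2_e 5) $ 2 = 0" "f (W2_e 5) $ 4 = 0"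
    by (simp_all add: W2_Aut_image_in_square[OF f])
  have f1: "f (W2_e 1) = W2_e 1 + c *s W2_e 3"
  proof -
    have "f (W2_e 1) $ 1 = 1" "f (W2_e 1) $ 5 = 0"
      using prod[of "W2_e 3" "W2_e 1"] cancel[of "f (W2_e 1) $ 1" 1] cancel_0
      by (simp_all add: coords)
    moreover have "f (W2_e 1) $ 6 = 0"
      using prod[of "W2_e 1" "W2_e 1"] calculation S halve[of 0 "f (W2_e 1) $ 6"]
      by (simp add: coords)
    ultimately show ?thesis
      using S by (simp add: coords c_def)
  qed
  have f5: "f (W2_e 5) = (b - 1) *s W2_e 1 + ((b - 1) * c) *s W2_e 3 + b *s W2_e 5
      + (b * c) *s W2_e 6"
  proof -
    have "f (W2_e 5) $ 1 = b - 1"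
      using prod[of "W2_e 5" "W2_e 3"] cancel[of "f (W2_e 5) $ 5 - f (W2_e 5) $ 1" 1]
      by (simp add: coords b_def mult.commute[of _ a] diff_eq_eq eq_diff_eq add.commute)
    moreover have "f (W2_e 5) $ 3 = (b - 1) * c" "f (W2_e 5) $ 6 = b * c"
      using prod[of "W2_e 1" "W2_e 5"] calculation halve[of "c * (b - 1)" "f (W2_e 5) $ 3"]
        halve[of "c * b" "f (W2_e 5) $ 6"]
      by (simp_all add: coords f1 b_def mult.commute[of c])
    ultimately show ?thesis
      using S by (simp add: coords b_def)
  qed
  have f6: "f (W2_e 6) = (a * (b - 1)) *s W2_e 3 + (a * b) *s W2_e 6"
    using prod[of "W2_e 3" "W2_e 5"] by (simp add: coords f5)
  have f2: "f (W2_e 2) = - (c * t) *s W2_e 1 + t *s W2_e 2 + (c * c * t) *s W2_e 3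
      - (c * c * c * t) *s W2_e 4"
  proof -
    have y2: "f (W2_e 2) $ 2 = t" and y1: "f (W2_e 2) $ 1 = - (c * t)" and y5: "f (W2_e 2) $ 5 = 0"
      using prod[of "W2_e 3" "W2_e 2"] cancel[of "f (W2_e 2) $ 2" t]
        cancel[of "f (W2_e 2) $ 1" "- (c * t)"] cancel_0[of "f (W2_e 2) $ 5"]
      by (simp_all add: coords f1 at mult.left_commute[of a])
    have y3: "f (W2_e 2) $ 3 = c * c * t" and y6: "f (W2_e 2) $ 6 = 0"
      using prod[of "W2_e 1" "W2_e 2"]
      by (simp_all add: coords f1 y1 y5 mult.assoc)
    \<comment> \<open>The third coordinate of \<open>f(e\<^sub>2)f(e\<^sub>2) = 0\<close>, in which \<open>k\<close> is minus the product of the first and the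
      third coordinate of \<open>f(e\<^sub>2)\<close>.\<close>
    define k where "k = c * t * (c * c * t)"
    have "- k - k + t * f (W2_e 2) $ 4 = 0"
      using prod[of "W2_e 2" "W2_e 2"]
      by (simp add: coords y1 y2 y3 y5 y6 k_def mult.commute[of "c * c * t"])
    then have "t * f (W2_e 2) $ 4 = k + k"
      by (simp add: algebra_simps)
    then have "t * f (W2_e 2) $ 4 = - k"
      by (simp only: uminus_char_3)
    then have "f (W2_e 2) $ 4 = - (a * k)"
      using unit_inverse_cancel(1)[OF at, of "f (W2_e 2) $ 4"] by simp
    also have "a * k = c * c * c * t"
      unfolding k_def by (simp add: mult.assoc unit_inverse_cancel[OF at])
    finally have "f (W2_e 2) $ 4 = - (c * c * c * t)" .
    then show ?thesis
      by (simp add: coords y1 y2 y3 y5 y6)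
  qed
  have f4: "f (W2_e 4) = (a * a) *s W2_e 4"
  proof -
    obtain l where l: "f (W2_e 4) = l *s W2_e 4"
      using W2_Aut_e4[OF f] by metis
    have "t * l = a"
      using prod[of "W2_e 2" "W2_e 4"] f2 by (simp add: coords l)
    then have "l = a * a"
      using unit_inverse_cancel(1)[OF at, of l] by simp
    then show ?thesis
      using l by simp
  qed
  have "a dvd 1"
    using at by (metis dvdI)
  moreover have "row_matrix f = W2_matrix a b c"
    using f1 f2 f3 f4 f5 f6 units_group_inv_eq[OF at]
    by (simp add: row_matrix_def W2_matrix_def vec_eq_iff forall_6 axis_6_nth
        power2_eq_square power3_eq_cube mult.assoc)
  ultimately show ?thesis by blast
qed

lemma carrier_W2_Aut:
  "carrier (W2_Aut :: ('a ^ 6 \<Rightarrow> 'a ^ 6) monoid) =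
    {row_map (W2_matrix a b c) | a b c. a dvd 1 \<and> b dvd 1}"
proof (intro equalityI subsetI)
  fix f :: "'a ^ 6 \<Rightarrow> 'a ^ 6"
  assume f: "f \<in> carrier W2_Aut"
  obtain g where g: "g \<in> carrier W2_Aut" and fg: "\<And>x. f (g x) = x"
    using W2_Aut_inverse[OF f] by metis
  have *: "h = row_map (row_matrix h)" if "h \<in> carrier W2_Aut" for h :: "'a ^ 6 \<Rightarrow> 'a ^ 6"
    using that R_linear_imp_row_map by (auto simp: W2_Aut_def)
  obtain a b c a' b' c' where a: "a dvd 1" "a' dvd 1" and f_eq: "f = row_map (W2_matrix a b c)"
    and g_eq: "g = row_map (W2_matrix a' b' c')"
    using W2_Aut_row_matrix[OF f] W2_Aut_row_matrix[OF g] *[OF f] *[OF g] by metis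
  obtain t t' where "a * t = 1" "a' * t' = 1"
    using a unfolding dvd_def by metis
  \<comment> \<open>The fifth coordinate is only scaled, so the scalars of \<open>f\<close> and of its inverse are inverse to each
    other.\<close>
  then have "f (g (W2_e 5)) $ 5 = b * b'"
    unfolding f_eq g_eq by (simp add: W2_map_nth axis_6_nth)
  then have "b dvd 1"
    by (simp add: fg axis_6_nth) (metis dvdI)
  with a f_eq show "f \<in> {row_map (W2_matrix a b c) | a b c. a dvd 1 \<and> b dvd 1}"
    by blast
qed (auto intro: W2_map_in_Aut)

section \<open>The group of automorphisms\<close>

text \<open>
  A central element commutes with the diagonal matrix with entries 1, -1, which gives \<open>x = -x\<close> and hence
  \<open>x = 0\<close> as \<open>3 = 0\<close>; then commuting with one translation gives \<open>t = 1\<close>. The unit -1 is what makes the center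
  trivial even if the ring has few units.
\<close>

lemma group_center_aff2: "group_center aff2_group = {\<one>\<^bsub>aff2_group\<^esub> :: 'a ^ 2 ^ 2}"
proof -
  let ?M = "\<lambda>x t. vector [vector [1, x], vector [0, t]] :: 'a ^ 2 ^ 2"
  have carrier: "carrier aff2_group = {?M x t | x t. t dvd 1}"
    and mult: "?M x t \<otimes>\<^bsub>aff2_group\<^esub> ?M x' t' = ?M (x' + x * t') (t * t')"
    and one: "\<one>\<^bsub>aff2_group\<^esub> = ?M 0 1" for x t x' t'
    by (simp_all add: aff2_group_def matrix_prod_aff2 aff2_one)
  have eq: "?M x t = ?M x' t' \<longleftrightarrow> x = x' \<and> t = t'" for x t x' t'
    by (auto simp: vec_eq_iff forall_2)
  have units: "1 dvd (1::'a)" "- 1 dvd (1::'a)"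
    by (metis dvdI mult_1, metis dvdI minus_mult_minus mult_1)
  have "x = 0 \<and> t = 1" if "?M x t \<in> group_center aff2_group" for x t
  proof -
    have comm: "x' + x * t' = x + x' * t" if "t' dvd 1" for x' t'
    proof -
      have "?M x' t' \<in> carrier aff2_group"
        using that by (auto simp: carrier)
      then have "?M x t \<otimes>\<^bsub>aff2_group\<^esub> ?M x' t' = ?M x' t' \<otimes>\<^bsub>aff2_group\<^esub> ?M x t"
        using \<open>?M x t \<in> group_center aff2_group\<close> by (simp add: group_center_def)
      then show ?thesis
        by (simp add: mult eq)
    qed
    \<comment> \<open>the diagonal matrix with entries 1, -1\<close>
    have "x = - x"
      using comm[of "- 1" 0] units by simp
    then have "x = 0"
      using uminus_char_3[of x] triple_eq_0[of x] by simp
    then show ?thesis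
      using comm[of 1 1] units by simp
  qed
  moreover have "?M 0 1 \<in> carrier aff2_group"
    using units unfolding carrier by blast
  then have "?M 0 1 \<in> group_center aff2_group"
    unfolding one[symmetric]
    by (simp add: group_center_def group.is_monoid[OF group_aff2_group] monoid.l_one monoid.r_one)
  ultimately show ?thesis
    by (auto simp: one group_center_def[where G = aff2_group] carrier)
qed

text \<open>
  Composing two maps with parameters \<open>(x, t)\<close> and \<open>(x', t')\<close>, the first two coordinates of the image of
  \<open>e\<^sub>2\<close> become \<open>x' + x t'\<close> and \<open>t t'\<close>, because the fifth coordinate stays zero; this is the product in the
  affine group. The parameters \<open>a = 1/t\<close> and \<open>c = -x a\<close> are recovered from \<open>x\<close> and \<open>t\<close>, which gives bijectivity.
\<close>

lemma W2_params_iso: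
  "W2_params \<in> iso (W2_Aut :: ('a ^ 6 \<Rightarrow> 'a ^ 6) monoid) (units_group \<times>\<times> aff2_group)"
proof (rule isoI)
  have unit_dvd: "u dvd 1" "v dvd 1" if "u * v = 1" for u v :: 'a
    using that by (metis dvdI, metis dvdI mult.commute)
  have unitE: "\<exists>v. u * v = 1 \<and> v dvd 1" if "u dvd 1" for u :: 'a
    using that unit_dvd unfolding dvd_def by metis
  have AutE: thesis
    if f: "f \<in> carrier W2_Aut" and *: "\<And>a t b c. a * t = 1 \<Longrightarrow> t dvd 1 \<Longrightarrow> b dvd 1 \<Longrightarrow>
      f = row_map (W2_matrix a b c) \<Longrightarrow> thesis"
    for f :: "'a ^ 6 \<Rightarrow> 'a ^ 6" and thesis
  proof -
    obtain a b c where "a dvd 1" "b dvd 1" "f = row_map (W2_matrix a b c)"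
      using f unfolding carrier_W2_Aut by blast
    moreover from this obtain t where "a * t = 1" "t dvd 1"
      using unitE by blast
    ultimately show thesis
      using * by blast
  qed
  have params: "W2_params (row_map (W2_matrix a b c)) =
      (b, vector [vector [1, - (c * t)], vector [0, t]])" if "a * t = 1" for a t b c :: 'a
    by (simp add: W2_params_def W2_map_nth[OF that] axis_6_nth)
  show hom: "W2_params \<in> hom (W2_Aut :: ('a ^ 6 \<Rightarrow> 'a ^ 6) monoid) (units_group \<times>\<times> aff2_group)"
  proof (rule homI)
    fix f :: "'a ^ 6 \<Rightarrow> 'a ^ 6"
    assume "f \<in> carrier W2_Aut"
    then obtain a t b c where "a * t = 1" "t dvd 1" "b dvd 1" "f = row_map (W2_matrix a b c)"
      by (rule AutE)
    then show "W2_params f \<in> carrier (units_group \<times>\<times> aff2_group)"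
      by (auto simp: params aff2_group_def)
  next
    fix f g :: "'a ^ 6 \<Rightarrow> 'a ^ 6"
    assume f: "f \<in> carrier W2_Aut" and g: "g \<in> carrier W2_Aut"
    obtain a t b c where "a * t = 1" "f = row_map (W2_matrix a b c)"
      by (rule AutE[OF f])
    moreover obtain a' t' b' c' where "a' * t' = 1" "g = row_map (W2_matrix a' b' c')"
      by (rule AutE[OF g])
    ultimately show "W2_params (f \<otimes>\<^bsub>W2_Aut\<^esub> g) = W2_params f \<otimes>\<^bsub>units_group \<times>\<times> aff2_group\<^esub> W2_params g"
      by (simp add: params W2_params_def W2_map_nth axis_6_nth W2_Aut_def aff2_group_def
          matrix_prod_aff2 mult.assoc)
  qed
  show "bij_betw W2_params (carrier W2_Aut) (carrier (units_group \<times>\<times> aff2_group :: ('a \<times> ('a ^ 2 ^ 2)) monoid))"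
    unfolding bij_betw_def
  proof (intro conjI inj_onI)
    fix f g :: "'a ^ 6 \<Rightarrow> 'a ^ 6"
    assume f_Aut: "f \<in> carrier W2_Aut" and g_Aut: "g \<in> carrier W2_Aut"
      and eq: "W2_params f = W2_params g"
    obtain a t b c where f: "a * t = 1" "f = row_map (W2_matrix a b c)"
      by (rule AutE[OF f_Aut])
    obtain a' t' b' c' where g: "a' * t' = 1" "g = row_map (W2_matrix a' b' c')"
      by (rule AutE[OF g_Aut])
    from eq have "b = b'" "t = t'" "c * t = c' * t'"
      by (auto simp: f params[OF f(1)] g params[OF g(1)] vec_eq_iff forall_2)
    moreover have ta: "t * a = 1" "t' * a' = 1"
      using f(1) g(1) by (simp_all add: mult.commute)
    moreover have "a = a * (t' * a')" "a' = a * (t * a')"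
      using ta unit_inverse_cancel(1)[OF f(1)] by simp_all
    moreover have "c = c * t * a" "c' = c' * t' * a'"
      using ta by (simp_all add: mult.assoc)
    ultimately show "f = g"
      using f(2) g(2) by simp
  next
    have "p \<in> W2_params ` carrier W2_Aut"
      if "p \<in> carrier (units_group \<times>\<times> aff2_group)" for p :: "'a \<times> ('a ^ 2 ^ 2)"
    proof -
      from that obtain b x t where b: "b dvd 1" "t dvd 1"
        and p: "p = (b, vector [vector [1, x], vector [0, t]])"
        by (auto simp: aff2_group_def)
      then obtain a where "t * a = 1" "a dvd 1"
        using unitE by blast
      then have at: "a * t = 1"
        by (simp add: mult.commute)
      then have "- (- (x * a) * t) = x"
        by (simp add: mult.assoc)
      then have "p = W2_params (row_map (W2_matrix a b (- (x * a))))"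
        by (simp only: params[OF at] p)
      then show ?thesis
        using W2_map_in_Aut[OF \<open>a dvd 1\<close> b(1)] by blast
    qed
    moreover note hom_carrier[OF hom]
    ultimately show "W2_params ` carrier W2_Aut = carrier (units_group \<times>\<times> aff2_group :: ('a \<times> ('a ^ 2 ^ 2)) monoid)"
      by blast
  qed
qed

end


theorem theorem22:
  assumes "\<forall>r::'a::comm_unital_ring. 3 * r = 0"
  shows "(\<exists>\<phi> \<in> iso (W2_Aut :: ('a ^ 6 \<Rightarrow> 'a ^ 6) monoid)
                    ((units_group :: 'a monoid) \<times>\<times> (aff2_group :: ('a ^ 2 ^ 2) monoid)).
            \<phi> ` group_center W2_Aut = carrier units_group \<times> {\<one>\<^bsub>aff2_group\<^esub>} \<and>
            {\<theta> \<in> carrier W2_Aut. \<phi> \<theta> \<in> carrier units_group \<times> {\<one>\<^bsub>aff2_group\<^esub>}} \<lhd> W2_Aut \<and>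
            {\<theta> \<in> carrier W2_Aut. \<phi> \<theta> \<in> {\<one>\<^bsub>units_group\<^esub>} \<times> carrier aff2_group} \<lhd> W2_Aut) \<and>
         carrier (W2_Aut :: ('a ^ 6 \<Rightarrow> 'a ^ 6) monoid) =
           {\<theta>. R_linear \<theta> \<and>
              (\<exists>a \<in> carrier units_group. \<exists>b \<in> carrier units_group. \<exists>c.
                 row_matrix \<theta> = W2_matrix a b c)}"
proof -
  let ?A = "W2_Aut :: ('a ^ 6 \<Rightarrow> 'a ^ 6) monoid"
  let ?U = "units_group :: 'a monoid" and ?B = "aff2_group :: ('a ^ 2 ^ 2) monoid"
  interpret A: group ?A by (rule group_W2_Aut)
  interpret U: group ?U by (rule group_units_group)
  interpret B: group ?B by (rule group_aff2_group)
  note iso = W2_params_iso[OF assms]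
  have hom: "W2_params \<in> hom ?A (?U \<times>\<times> ?B)"
    using iso by (rule iso_imp_homomorphism)
  then have carrier: "W2_params \<theta> \<in> carrier ?U \<times> carrier ?B" if "\<theta> \<in> carrier ?A" for \<theta>
    using that by (auto simp: hom_def)
  have homs: "fst \<circ> W2_params \<in> hom ?A ?U" "snd \<circ> W2_params \<in> hom ?A ?B"
    using hom by (simp_all add: hom_pairwise)
  have "group_center ?U = carrier ?U"
    by (auto simp: group_center_def mult.commute)
  then have "W2_params ` group_center ?A = carrier ?U \<times> {\<one>\<^bsub>?B\<^esub>}"
    by (simp add: group_center_iso_image[OF iso group_W2_Aut] group_center_DirProd U.is_group
        B.is_group group_center_aff2[OF assms])
  moreover have "{\<theta> \<in> carrier ?A. W2_params \<theta> \<in> carrier ?U \<times> {\<one>\<^bsub>?B\<^esub>}} = kernel ?A ?B (snd \<circ> W2_params)"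
    using carrier by (fastforce simp: kernel_def)
  then have "{\<theta> \<in> carrier ?A. W2_params \<theta> \<in> carrier ?U \<times> {\<one>\<^bsub>?B\<^esub>}} \<lhd> ?A"
    using homs by (simp add: group_hom.normal_kernel group_hom_def group_hom_axioms_def
        A.is_group B.is_group)
  moreover have "{\<theta> \<in> carrier ?A. W2_params \<theta> \<in> {\<one>\<^bsub>?U\<^esub>} \<times> carrier ?B} = kernel ?A ?U (fst \<circ> W2_params)"
    using carrier by (fastforce simp: kernel_def)
  then have "{\<theta> \<in> carrier ?A. W2_params \<theta> \<in> {\<one>\<^bsub>?U\<^esub>} \<times> carrier ?B} \<lhd> ?A"
    using homs by (simp add: group_hom.normal_kernel group_hom_def group_hom_axioms_def
        A.is_group U.is_group)
  moreover have "carrier ?A = {\<theta>. R_linear \<theta> \<and>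
      (\<exists>a \<in> carrier ?U. \<exists>b \<in> carrier ?U. \<exists>c. row_matrix \<theta> = W2_matrix a b c)}"
  proof -
    have *: "\<theta> = row_map M \<longleftrightarrow> R_linear \<theta> \<and> row_matrix \<theta> = M" for \<theta> :: "'a ^ 6 \<Rightarrow> 'a ^ 6" and M
      using R_linear_imp_row_map R_linear_row_map row_matrix_row_map by metis
    then show ?thesis
      unfolding carrier_W2_Aut[OF assms] * Bex_def units_group_simps by blast
  qed
  ultimately show ?thesis
    by (intro conjI bexI[OF _ iso])
qed

end
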